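(* Let $G$ be a graph and let $\ell$ be a weakly subadditive nonnegative integer-valued function on subsets of $V(G)$ with $\ell(\emptyset)=\ell(V(G))=0$. Then $G$ is minimally $\ell$-rigid if and only if $G$ has an $\ell$-arc-connected orientation such that $d^-_G(v)=\ell(v)$ for each vertex $v$.
   Context: Graphs are finite, loopless, multiple edges allowed. $e_G(X)$ is the number of edges with both ends in $X$; $\ell(v)=\ell(\{v\})$; weakly subadditive means $\sum_{v\in A}\ell(v)\ge\ell(A)$ for all $A$. $G$ is minimally $\ell$-rigid if $e_G(X)\le\sum_{v\in X}\ell(v)-\ell(X)$ for all $X\subseteq V(G)$ and $|E(G)|=\sum_{v\in V(G)}\ell(v)-\ell(V(G))$ (equivalently, $G$ is $\ell$-rigid but no proper spanning subgraph is). In an orientation, $d^-(v)$ is the number of arcs entering $v$ and $d^-(A)$ is the number of arcs entering $A$ (tail outside $A$, head in $A$); the orientation is $\ell$-arc-connected if $d^-(A)\ge\ell(A)$ for every vertex set $A$. *)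

theory Defs
  imports "Graph_Theory.Digraph"
begin

(* Undirected multigraphs: edges are abstract objects, so parallel edges are distinct
   elements of the edge set with the same two-element set of ends. *)
record ('v, 'e) multigraph =
  vertices :: "'v set"
  edges :: "'e set"
  ends :: "'e \<Rightarrow> 'v set"

locale finite_multigraph =
  fixes G :: "('v, 'e) multigraph"
  assumes finite_vertices: "finite (vertices G)"
    and finite_edges: "finite (edges G)"
    and ends_subset: "e \<in> edges G \<Longrightarrow> ends G e \<subseteq> vertices G"
    and card_ends: "e \<in> edges G \<Longrightarrow> card (ends G e) = 2"

definition induced_edge_count :: "('v, 'e) multigraph \<Rightarrow> 'v set \<Rightarrow> nat" where
  "induced_edge_count G X = card {e \<in> edges G. ends G e \<subseteq> X}"

definition weakly_subadditive_on :: "'v set \<Rightarrow> ('v set \<Rightarrow> int) \<Rightarrow> bool" where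
  "weakly_subadditive_on V l \<longleftrightarrow> (\<forall>A\<subseteq>V. l A \<le> (\<Sum>v\<in>A. l {v}))"

definition minimally_rigid :: "('v set \<Rightarrow> int) \<Rightarrow> ('v, 'e) multigraph \<Rightarrow> bool" where
  "minimally_rigid l G \<longleftrightarrow>
     (\<forall>X\<subseteq>vertices G. int (induced_edge_count G X) \<le> (\<Sum>v\<in>X. l {v}) - l X) \<and>
     int (card (edges G)) = (\<Sum>v\<in>vertices G. l {v}) - l (vertices G)"

definition orientation_of :: "('v, 'e) pre_digraph \<Rightarrow> ('v, 'e) multigraph \<Rightarrow> bool" where
  "orientation_of D G \<longleftrightarrow>
     verts D = vertices G \<and> arcs D = edges G \<and>
     (\<forall>e\<in>edges G. {tail D e, head D e} = ends G e)"

definition set_in_degree :: "('v, 'e) pre_digraph \<Rightarrow> 'v set \<Rightarrow> nat" where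
  "set_in_degree D A = card {e \<in> arcs D. tail D e \<notin> A \<and> head D e \<in> A}"

definition arc_connected :: "('v set \<Rightarrow> int) \<Rightarrow> ('v, 'e) pre_digraph \<Rightarrow> bool" where
  "arc_connected l D \<longleftrightarrow> (\<forall>A\<subseteq>verts D. l A \<le> int (set_in_degree D A))"

end

theory Submission
  imports Defs
begin

text \<open>
  In an orientation, the arcs with head in \<open>A\<close> either enter \<open>A\<close> or lie inside \<open>A\<close>, so
  the in-degree of \<open>A\<close> is the sum of the in-degrees of its vertices minus the number of edges
  induced by \<open>A\<close>. Once the in-degrees are prescribed by \<open>l\<close>, arc-connectivity is therefore the
  same as the sparsity condition. The remaining point is Hakimi's theorem: an orientation with
  in-degrees at most \<open>m\<close> exists if every \<open>X\<close> induces at most \<open>m(X)\<close> edges. It is proved by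
  orienting one edge \<open>uv\<close> at a time; if neither direction preserved the hypothesis, there would be
  a tight set containing \<open>v\<close> but not \<open>u\<close> and one containing \<open>u\<close> but not \<open>v\<close>, contradicting
  supermodularity of the induced edge count, which is strict here because of \<open>uv\<close>.
\<close>

lemma card_vimage_eq_sum_card_fibres:
  assumes "finite E" "finite A"
  shows "card {e \<in> E. h e \<in> A} = (\<Sum>v\<in>A. card {e \<in> E. h e = v})"
proof -
  have "{e \<in> E. h e \<in> A} = (\<Union>v\<in>A. {e \<in> E. h e = v})" by auto
  also have "card \<dots> = (\<Sum>v\<in>A. card {e \<in> E. h e = v})"
    by (rule card_UN_disjoint) (use assms in auto)
  finally show ?thesis .
qed

text \<open>An edge inside \<open>X\<close> or inside \<open>Y\<close> is inside the union, and it
  is inside both exactly when it is inside the intersection. The edge \<open>e0\<close> contributes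
  only to the count for the union, hence strictness.\<close>

lemma card_induced_supermodular_strict:
  fixes inc :: "'e \<Rightarrow> 'v set"
  assumes "finite E" "e0 \<in> E" "inc e0 \<subseteq> X \<union> Y" "\<not> inc e0 \<subseteq> X" "\<not> inc e0 \<subseteq> Y"
  shows "card {e \<in> E. inc e \<subseteq> X} + card {e \<in> E. inc e \<subseteq> Y} <
         card {e \<in> E. inc e \<subseteq> X \<union> Y} + card {e \<in> E. inc e \<subseteq> X \<inter> Y}"
proof -
  let ?I = "\<lambda>X. {e \<in> E. inc e \<subseteq> X}"
  have "card (?I X) + card (?I Y) = card (?I X \<union> ?I Y) + card (?I X \<inter> ?I Y)"
    by (rule card_Un_Int) (use assms in auto)
  moreover have "?I X \<inter> ?I Y = ?I (X \<inter> Y)" by auto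
  moreover have "card (?I X \<union> ?I Y) < card (?I (X \<union> Y))"
    by (rule psubset_card_mono) (use assms in auto)
  ultimately show ?thesis by simp
qed

text \<open>An orientation is encoded by its choice of heads \<open>h\<close>, and \<open>m\<close>
  is a budget of heads per vertex. Only upper bounds are claimed, which suits induction on the
  edges; equality comes later from the total.\<close>

lemma ex_head_assignment_le:
  fixes m :: "'v \<Rightarrow> int" and inc :: "'e \<Rightarrow> 'v set"
  assumes "finite E" "finite V"
    and "\<And>e. e \<in> E \<Longrightarrow> inc e \<subseteq> V" "\<And>e. e \<in> E \<Longrightarrow> card (inc e) = 2"
    and "\<And>X. X \<subseteq> V \<Longrightarrow> int (card {e \<in> E. inc e \<subseteq> X}) \<le> sum m X"
  shows "\<exists>h. (\<forall>e\<in>E. h e \<in> inc e) \<and> (\<forall>v\<in>V. int (card {e \<in> E. h e = v}) \<le> m v)"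
  using assms
\<comment> \<open>The budget varies because giving an edge the head \<open>w\<close> lowers
  \<open>m w\<close> by one for the remaining edges.\<close>
proof (induction E arbitrary: m rule: finite_induct)
  case empty
  have "0 \<le> m v" if "v \<in> V" for v
    using empty.prems(4)[of "{v}"] that by simp
  then show ?case by simp
next
  case (insert e0 E)
  let ?I = "\<lambda>X. {e \<in> E. inc e \<subseteq> X}"
  let ?J = "\<lambda>X. {e \<in> insert e0 E. inc e \<subseteq> X}"
  obtain u v where e0: "inc e0 = {u, v}" "u \<noteq> v"
    using insert.prems(3)[of e0] by (auto simp: card_2_iff)
  have uvV: "u \<in> V" "v \<in> V" using insert.prems(2)[of e0] e0 by auto
  have finsub: "finite X" if "X \<subseteq> V" for X
    using that \<open>finite V\<close> finite_subset by blast
  have cardJ: "card (?J X) = card (?I X) + (if inc e0 \<subseteq> X then 1 else 0)" for X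
  proof (cases "inc e0 \<subseteq> X")
    case True
    then have "?J X = insert e0 (?I X)" by auto
    then show ?thesis using True insert.hyps by simp
  next
    case False
    then have "?J X = ?I X" by auto
    then show ?thesis using False by simp
  qed
  have sum_upd: "sum (m(w := m w - 1)) X = sum m X - (if w \<in> X then 1 else 0)"
    if "X \<subseteq> V" for w X
  proof (cases "w \<in> X")
    case True
    then have "sum (m(w := m w - 1)) X = (m w - 1) + sum (m(w := m w - 1)) (X - {w})"
      using sum.remove[of X w "m(w := m w - 1)"] finsub[OF that] by simp
    also have "sum (m(w := m w - 1)) (X - {w}) = sum m (X - {w})"
      by (rule sum.cong) auto
    finally show ?thesis
      using sum.remove[of X w m] True finsub[OF that] by simp
  next
    case False
    then show ?thesis by (auto intro!: sum.cong)
  qed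
  \<comment> \<open>Giving \<open>e0\<close> the head \<open>w\<close> returns the unit withheld
    from \<open>m w\<close>, so heads found for \<open>E\<close> under the lowered budget extend to
    \<open>e0\<close>.\<close>
  have extend: ?case if w: "w \<in> inc e0"
    and sparse: "\<And>X. X \<subseteq> V \<Longrightarrow> int (card (?I X)) \<le> sum (m(w := m w - 1)) X" for w
  proof -
    obtain h where h: "\<And>e. e \<in> E \<Longrightarrow> h e \<in> inc e"
      "\<And>x. x \<in> V \<Longrightarrow> int (card {e \<in> E. h e = x}) \<le> (m(w := m w - 1)) x"
      using insert.IH[OF \<open>finite V\<close> insert.prems(2,3) sparse] by auto
    let ?h = "h(e0 := w)"
    have "int (card {e \<in> insert e0 E. ?h e = x}) \<le> m x" if "x \<in> V" for x
    proof (cases "x = w")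
      case True
      then have "{e \<in> insert e0 E. ?h e = x} = insert e0 {e \<in> E. h e = x}" by auto
      then show ?thesis using True h(2)[OF that] insert.hyps by simp
    next
      case False
      then have "{e \<in> insert e0 E. ?h e = x} = {e \<in> E. h e = x}"
        using insert.hyps by auto
      then show ?thesis using False h(2)[OF that] by simp
    qed
    moreover have "\<forall>e\<in>insert e0 E. ?h e \<in> inc e" using h(1) w by auto
    ultimately show ?thesis by blast
  qed
  have tight: "\<exists>X\<subseteq>V. w \<in> X \<and> \<not> inc e0 \<subseteq> X \<and> int (card (?J X)) = sum m X"
    if fail: "\<not> (\<forall>X\<subseteq>V. int (card (?I X)) \<le> sum (m(w := m w - 1)) X)" for w
  proof -
    obtain X where X: "X \<subseteq> V" "sum (m(w := m w - 1)) X < int (card (?I X))"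
      using fail by (auto simp: not_le)
    \<comment> \<open>The lowered budget is exceeded on \<open>X\<close> although
      \<open>?J X\<close> obeyed the original one. Lowering costs at most 1, so by integrality
      \<open>w\<close> is in \<open>X\<close>, \<open>e0\<close> is not inside \<open>X\<close>, and
      the original bound is attained.\<close>
    have "w \<in> X \<and> \<not> inc e0 \<subseteq> X \<and> int (card (?J X)) = sum m X"
      using X(2) sum_upd[OF X(1), of w] cardJ[of X] insert.prems(4)[OF X(1)]
      by (cases "w \<in> X"; cases "inc e0 \<subseteq> X"; simp only: if_True if_False simp_thms; linarith)
    then show ?thesis using X(1) by blast
  qed
  show ?case
  proof (rule ccontr)
    assume no: "\<not> ?case"
    have fail: "\<not> (\<forall>X\<subseteq>V. int (card (?I X)) \<le> sum (m(w := m w - 1)) X)" if "w \<in> inc e0" for w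
    proof
      assume "\<forall>X\<subseteq>V. int (card (?I X)) \<le> sum (m(w := m w - 1)) X"
      then have ?case by - (rule extend[OF that], simp only: mp)
      with no show False by contradiction
    qed
    obtain X where X: "X \<subseteq> V" "v \<in> X" "\<not> inc e0 \<subseteq> X" "int (card (?J X)) = sum m X"
      using tight[OF fail[of v]] e0 by auto
    obtain Y where Y: "Y \<subseteq> V" "u \<in> Y" "\<not> inc e0 \<subseteq> Y" "int (card (?J Y)) = sum m Y"
      using tight[OF fail[of u]] e0 by auto
    \<comment> \<open>Since \<open>v\<close> is in \<open>X\<close> and \<open>u\<close> is in
      \<open>Y\<close>, both ends of \<open>e0\<close> lie in the union, while neither set alone
      contains them: the strict case.\<close>
    have "card (?J X) + card (?J Y) < card (?J (X \<union> Y)) + card (?J (X \<inter> Y))"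
      by (rule card_induced_supermodular_strict[of _ e0]) (use insert.hyps X Y e0 in auto)
    moreover have "int (card (?J (X \<union> Y))) \<le> sum m (X \<union> Y)"
      "int (card (?J (X \<inter> Y))) \<le> sum m (X \<inter> Y)"
      by (rule insert.prems(4), use X(1) Y(1) in blast)+
    moreover have "sum m (X \<union> Y) + sum m (X \<inter> Y) = sum m X + sum m Y"
      using X Y finsub by (simp add: sum.union_inter)
    ultimately show False using X(4) Y(4) by linarith
  qed
qed

context finite_multigraph
begin

lemma set_in_degree_plus_induced_edge_count:
  assumes D: "orientation_of D G" and A: "A \<subseteq> vertices G"
  shows "set_in_degree D A + induced_edge_count G A = (\<Sum>v\<in>A. in_degree D v)"
proof -
  have arcs: "arcs D = edges G" and ends: "\<And>e. e \<in> edges G \<Longrightarrow> ends G e = {tail D e, head D e}"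
    using D by (auto simp: orientation_of_def)
  let ?S = "{e \<in> edges G. tail D e \<notin> A \<and> head D e \<in> A}"
  let ?I = "{e \<in> edges G. ends G e \<subseteq> A}"
  have "{e \<in> edges G. head D e \<in> A} = ?S \<union> ?I" "?S \<inter> ?I = {}"
    using ends by auto
  then have "card ?S + card ?I = card {e \<in> edges G. head D e \<in> A}"
    using finite_edges by (simp add: card_Un_disjoint)
  also have "\<dots> = (\<Sum>v\<in>A. card {e \<in> edges G. head D e = v})"
    using finite_edges finite_subset[OF A finite_vertices]
    by (rule card_vimage_eq_sum_card_fibres)
  finally show ?thesis
    by (simp add: set_in_degree_def induced_edge_count_def in_degree_def in_arcs_def arcs)
qed

lemma induced_edge_count_vertices: "induced_edge_count G (vertices G) = card (edges G)"
  unfolding induced_edge_count_def using ends_subset by (intro arg_cong[of _ _ card]) auto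

lemma set_in_degree_vertices:
  assumes "orientation_of D G"
  shows "set_in_degree D (vertices G) = 0"
proof -
  have "{e \<in> arcs D. tail D e \<notin> vertices G \<and> head D e \<in> vertices G} = {}"
    using assms ends_subset unfolding orientation_of_def by blast
  then show ?thesis by (simp only: set_in_degree_def card.empty)
qed

lemma ex_orientation_with_heads:
  assumes "\<And>e. e \<in> edges G \<Longrightarrow> h e \<in> ends G e"
  shows "\<exists>D. orientation_of D G \<and> head D = h"
proof -
  \<comment> \<open>The tail is the other one of the two ends.\<close>
  have "\<exists>t. {t, h e} = ends G e" if "e \<in> edges G" for e
    using card_ends[OF that] assms[OF that] by (auto simp: card_2_iff)
  then obtain t where "\<And>e. e \<in> edges G \<Longrightarrow> {t e, h e} = ends G e" by metis
  then have "orientation_of \<lparr>verts = vertices G, arcs = edges G, tail = t, head = h\<rparr> G"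
    by (simp add: orientation_of_def)
  then show ?thesis by (intro exI conjI) auto
qed

text \<open>In-degrees sum to the number of edges, which is also the total of \<open>m\<close>. The
  slacks \<open>m v - in_degree D v\<close> are therefore nonnegative with sum zero, so each
  vanishes.\<close>

theorem ex_orientation_in_degree_eq:
  fixes m :: "'v \<Rightarrow> int"
  assumes sparse: "\<And>X. X \<subseteq> vertices G \<Longrightarrow> int (induced_edge_count G X) \<le> sum m X"
    and total: "int (card (edges G)) = sum m (vertices G)"
  shows "\<exists>D. orientation_of D G \<and> (\<forall>v\<in>vertices G. int (in_degree D v) = m v)"
proof -
  obtain h where h: "\<And>e. e \<in> edges G \<Longrightarrow> h e \<in> ends G e"
    and le: "\<And>v. v \<in> vertices G \<Longrightarrow> int (card {e \<in> edges G. h e = v}) \<le> m v"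
    using ex_head_assignment_le[OF finite_edges finite_vertices ends_subset card_ends
        sparse[unfolded induced_edge_count_def]] by blast
  obtain D where D: "orientation_of D G" "head D = h"
    using ex_orientation_with_heads[OF h] by blast
  then have le': "int (in_degree D v) \<le> m v" if "v \<in> vertices G" for v
    using le[OF that] by (simp add: in_degree_def in_arcs_def orientation_of_def)
  have "(\<Sum>v\<in>vertices G. in_degree D v) = card (edges G)"
    using set_in_degree_plus_induced_edge_count[OF D(1) subset_refl]
      induced_edge_count_vertices set_in_degree_vertices[OF D(1)] by simp
  then have "(\<Sum>v\<in>vertices G. m v - int (in_degree D v)) = 0"
    using total by (simp add: sum_subtractf flip: of_nat_sum)
  then have "\<forall>v\<in>vertices G. m v - int (in_degree D v) = 0"
    by (subst (asm) sum_nonneg_eq_0_iff) (use finite_vertices le' in auto)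
  then show ?thesis using D(1) by auto
qed

end

theorem theorem7p2:
  fixes G :: "('v, 'e) multigraph" and l :: "'v set \<Rightarrow> int"
  assumes "finite_multigraph G"
    and "\<And>A. A \<subseteq> vertices G \<Longrightarrow> 0 \<le> l A"
    and "weakly_subadditive_on (vertices G) l"
    and "l {} = 0" and "l (vertices G) = 0"
  shows "minimally_rigid l G \<longleftrightarrow>
    (\<exists>D. orientation_of D G \<and> arc_connected l D \<and>
         (\<forall>v\<in>vertices G. int (in_degree D v) = l {v}))"
proof -
  interpret finite_multigraph G by fact
  have degree: "int (set_in_degree D A) + int (induced_edge_count G A) = (\<Sum>v\<in>A. l {v})"
    if "orientation_of D G" "\<forall>v\<in>vertices G. int (in_degree D v) = l {v}" "A \<subseteq> vertices G"
    for D :: "('v, 'e) pre_digraph" and A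
  proof -
    have "(\<Sum>v\<in>A. l {v}) = (\<Sum>v\<in>A. int (in_degree D v))"
      using that by (intro sum.cong) auto
    then show ?thesis
      using set_in_degree_plus_induced_edge_count[OF that(1,3)] by (simp flip: of_nat_sum)
  qed
  show ?thesis
  proof
    assume rigid: "minimally_rigid l G"
    then have sparse: "int (induced_edge_count G X) \<le> (\<Sum>v\<in>X. l {v}) - l X"
      if "X \<subseteq> vertices G" for X
      using that by (simp add: minimally_rigid_def)
    have "\<exists>D. orientation_of D G \<and> (\<forall>v\<in>vertices G. int (in_degree D v) = l {v})"
    proof (rule ex_orientation_in_degree_eq)
      \<comment> \<open>Nonnegativity of \<open>l\<close> allows the term \<open>- l X\<close> to be
        dropped; the full bound returns below for arc-connectivity.\<close>
      show "int (induced_edge_count G X) \<le> (\<Sum>v\<in>X. l {v})" if "X \<subseteq> vertices G" for X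
        using sparse[OF that] assms(2)[OF that] by linarith
      show "int (card (edges G)) = (\<Sum>v\<in>vertices G. l {v})"
        using rigid assms(5) by (simp add: minimally_rigid_def)
    qed
    then obtain D where D: "orientation_of D G" "\<forall>v\<in>vertices G. int (in_degree D v) = l {v}"
      by blast
    \<comment> \<open>Any orientation with these in-degrees will do: in the degree identity,
      sparsity of \<open>A\<close> leaves at least \<open>l A\<close> arcs to enter
      \<open>A\<close>.\<close>
    have "l A \<le> int (set_in_degree D A)" if "A \<subseteq> vertices G" for A
      using degree[OF D that] sparse[OF that] by linarith
    moreover have "verts D = vertices G" using D(1) by (simp add: orientation_of_def)
    ultimately show "\<exists>D. orientation_of D G \<and> arc_connected l D \<and>
        (\<forall>v\<in>vertices G. int (in_degree D v) = l {v})"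
      using D by (auto simp: arc_connected_def)
  next
    assume "\<exists>D. orientation_of D G \<and> arc_connected l D \<and>
        (\<forall>v\<in>vertices G. int (in_degree D v) = l {v})"
    then obtain D where D: "orientation_of D G" "\<forall>v\<in>vertices G. int (in_degree D v) = l {v}"
      and conn: "arc_connected l D" by blast
    have "int (induced_edge_count G X) \<le> (\<Sum>v\<in>X. l {v}) - l X" if "X \<subseteq> vertices G" for X
    proof -
      have "l X \<le> int (set_in_degree D X)"
        using conn that D(1) by (simp add: arc_connected_def orientation_of_def)
      then show ?thesis using degree[OF D that] by linarith
    qed
    \<comment> \<open>The degree identity is applied to the whole vertex set, which no arc enters
      and where \<open>l\<close> is 0.\<close>
    moreover have "int (card (edges G)) = (\<Sum>v\<in>vertices G. l {v}) - l (vertices G)"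
      using degree[OF D subset_refl] set_in_degree_vertices[OF D(1)]
        induced_edge_count_vertices assms(5) by simp
    ultimately show "minimally_rigid l G" by (simp add: minimally_rigid_def)
  qed
qed

end
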